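(* For all $\beta\in(1,2)$ and $\tau\in(0,0.5)$, the Hausdorff dimension of the attractor $\Lambda_{\beta,\tau}$ (defined in the context) is $$\dim_H\Lambda_{\beta,\tau}=1+\frac{\log\beta}{\log\tau^{-1}}.$$
   Context: For $\beta\in(1,2)$ and $\tau\in(0,0.5)$, the map $f:[0,1]^2\to[0,1]^2$ is given by $$f(x,y)=\begin{cases}(\beta x,\ \tau y), & x\in[0,\beta^{-1}],\\ (\beta x-1,\ \tau y+(1-\tau)), & x\in(\beta^{-1},1],\end{cases}$$ and its attractor is $$\Lambda_{\beta,\tau}=\mathrm{closure}\Big(\bigcap_{i=0}^{\infty}f^i([0,1]^2)\Big).$$ Here $\dim_H$ denotes the usual Hausdorff dimension of subsets of $\mathbb{R}^2$ with the Euclidean metric. *)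

theory Defs
  imports "HOL-Analysis.Analysis"
begin

text \<open>
  The contribution of a set of diameter d to the s-dimensional Hausdorff sum is d powr s, with the
  usual conventions that the empty set contributes 0 and that a nonempty set contributes 1 when
  s = 0. The latter is a separate case because 0 powr 0 = 0 in Isabelle/HOL.
\<close>
definition hausdorff_weight :: "real \<Rightarrow> 'a::metric_space set \<Rightarrow> ennreal" where
  "hausdorff_weight s U =
     (if U = {} then 0 else if s = 0 then 1 else ennreal (diameter U powr s))"

text \<open>Boundedness is required explicitly because \<^const>\<open>diameter\<close> is unspecified on unbounded sets.\<close>
definition delta_covers :: "real \<Rightarrow> 'a::metric_space set \<Rightarrow> (nat \<Rightarrow> 'a set) set" where
  "delta_covers \<delta> A = {U. A \<subseteq> (\<Union>i. U i) \<and> (\<forall>i. bounded (U i) \<and> diameter (U i) \<le> \<delta>)}"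

definition hausdorff_premeasure :: "real \<Rightarrow> real \<Rightarrow> 'a::metric_space set \<Rightarrow> ennreal" where
  "hausdorff_premeasure s \<delta> A = (INF U \<in> delta_covers \<delta> A. \<Sum>i. hausdorff_weight s (U i))"

definition hausdorff_measure :: "real \<Rightarrow> 'a::metric_space set \<Rightarrow> ennreal" where
  "hausdorff_measure s A = (SUP \<delta> \<in> {0<..}. hausdorff_premeasure s \<delta> A)"

definition hausdorff_dim :: "'a::metric_space set \<Rightarrow> ereal" where
  "hausdorff_dim A = (INF s \<in> {s. 0 \<le> s \<and> hausdorff_measure s A = 0}. ereal s)"

abbreviation unit_square :: "(real \<times> real) set" where
  "unit_square \<equiv> {0..1} \<times> {0..1}"

text \<open>
  The values outside the unit square are irrelevant: for the parameters considered the unit square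
  is mapped into itself. The metric on \<^typ>\<open>real \<times> real\<close> is the Euclidean one.
\<close>
definition baker_map :: "real \<Rightarrow> real \<Rightarrow> real \<times> real \<Rightarrow> real \<times> real" where
  "baker_map \<beta> \<tau> = (\<lambda>(x, y).
     if x \<le> inverse \<beta> then (\<beta> * x, \<tau> * y) else (\<beta> * x - 1, \<tau> * y + (1 - \<tau>)))"

definition baker_attractor :: "real \<Rightarrow> real \<Rightarrow> (real \<times> real) set" where
  "baker_attractor \<beta> \<tau> = closure (\<Inter>i::nat. (baker_map \<beta> \<tau> ^^ i) ` unit_square)"

lemma baker_map_unit_square:
  assumes "1 < \<beta>" "\<beta> < 2" "0 < \<tau>" "\<tau> < 1 / 2"
  shows "baker_map \<beta> \<tau> ` unit_square \<subseteq> unit_square"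
proof (rule image_subsetI)
  fix p assume "p \<in> unit_square"
  then obtain x y where p: "p = (x, y)" and xy: "0 \<le> x" "x \<le> 1" "0 \<le> y" "y \<le> 1"
    by auto
  have "0 \<le> \<beta> * x" "\<beta> * x \<le> 2" "0 \<le> \<tau> * y" "\<tau> * y \<le> \<tau>"
    using assms xy mult_mono[of \<beta> 2 x 1] by (auto simp: mult_left_le)
  moreover from this have "\<tau> * y \<le> 1"
    using assms by linarith
  moreover have "x \<le> inverse \<beta> \<longleftrightarrow> \<beta> * x \<le> 1"
    using assms by (simp add: field_simps)
  ultimately show "baker_map \<beta> \<tau> p \<in> unit_square"
    using assms by (auto simp: p baker_map_def)
qed

end

theory Submission
  imports Defs "HOL-Probability.Infinite_Product_Measure" "HOL-Real_Asymp.Real_Asymp"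
begin

text \<open>
  The \<open>n\<close>-th image of the square consists of at most \<open>2 ^ n\<close> strips of height \<open>\<tau> ^ n\<close> whose widths sum
  to \<open>\<beta> ^ n\<close>. Hence it is covered by \<open>(\<beta> / \<tau>) ^ n + 2 ^ n \<le> 2 * (\<beta> / \<tau>) ^ n\<close> squares of side \<open>\<tau> ^ n\<close>,
  which gives the upper bound.

  For the lower bound, call a strip full if it has width 1. Every narrower strip descends, without
  further splitting, from one that was born together with a full strip, and the number of full
  strips does not decrease; so at least \<open>\<beta> ^ n / (n + 1)\<close> of the strips of level \<open>n\<close> are full. Full
  words can be concatenated freely, so the attractor contains the product of \<open>{0<..1}\<close> and the
  self-similar set generated by the full words of length \<open>n\<close>. The mass distribution principle for
  the product of Lebesgue measure and the uniform measure on sequences of full words shows that the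
  dimension is at least \<open>1 + ln (\<beta> ^ n / (n + 1)) / (n * ln (inverse \<tau>))\<close>. Now let \<open>n\<close> grow.
\<close>

section \<open>Hausdorff measure\<close>

text \<open>The finite cover becomes a sequence by padding with empty sets, whose weight is 0. For
  \<open>0 < s\<close> the weight is monotone in the diameter, also at diameter 0.\<close>

lemma hausdorff_premeasure_le_card:
  fixes A :: "'a::metric_space set"
  assumes "finite F" "A \<subseteq> \<Union>F" "0 < s" "d \<le> \<delta>" "0 \<le> \<delta>"
    and F: "\<And>U. U \<in> F \<Longrightarrow> bounded U \<and> diameter U \<le> d"
  shows "hausdorff_premeasure s \<delta> A \<le> ennreal (real (card F) * d powr s)"
proof -
  obtain h where h: "bij_betw h {..<card F} F"
    using ex_bij_betw_nat_finite[OF \<open>finite F\<close>] by (auto simp: atLeast0LessThan)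
  define U where "U i = (if i < card F then h i else {})" for i
  have hF: "h i \<in> F" if "i < card F" for i
    using h that by (auto simp: bij_betw_def)
  have "A \<subseteq> (\<Union>i. U i)"
  proof
    fix x assume "x \<in> A"
    then obtain V where "V \<in> F" "x \<in> V" using assms by auto
    then obtain i where "i < card F" "h i = V" using h by (blast dest: bij_betw_imp_surj_on[THEN equalityD2, THEN subsetD])
    then show "x \<in> (\<Union>i. U i)" using \<open>x \<in> V\<close> by (auto simp: U_def intro!: exI[of _ i])
  qed
  moreover have "bounded (U i) \<and> diameter (U i) \<le> \<delta>" for i
    using F[OF hF, of i] assms(4,5) by (auto simp: U_def)
  ultimately have "U \<in> delta_covers \<delta> A"
    by (auto simp: delta_covers_def)
  then have "hausdorff_premeasure s \<delta> A \<le> (\<Sum>i. hausdorff_weight s (U i))"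
    unfolding hausdorff_premeasure_def by (rule INF_lower)
  also have "\<dots> = (\<Sum>i<card F. hausdorff_weight s (U i))"
    by (rule suminf_finite) (auto simp: U_def hausdorff_weight_def)
  also have "\<dots> \<le> (\<Sum>i<card F. ennreal (d powr s))"
  proof (rule sum_mono)
    fix i assume "i \<in> {..<card F}"
    then have "U i \<in> F" using hF by (auto simp: U_def)
    then have "bounded (U i)" "diameter (U i) \<le> d" using F by auto
    then show "hausdorff_weight s (U i) \<le> ennreal (d powr s)"
      using \<open>0 < s\<close> by (auto simp: hausdorff_weight_def intro!: ennreal_leI powr_mono2 diameter_ge_0)
  qed
  also have "\<dots> = ennreal (real (card F) * d powr s)"
    by (simp add: ennreal_of_nat_eq_real_of_nat ennreal_mult)
  finally show ?thesis .
qed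

section \<open>A mass distribution on a segment times a self-similar set\<close>

text \<open>The maps \<open>y -> c + \<rho> * y\<close> with \<open>c\<close> in \<open>C\<close>
  send the unit interval into itself, onto intervals with mutual gaps of at least
  \<open>\<gamma>\<close>. Their limit set is the self-similar set under study.\<close>

locale separated_digits =
  fixes C :: "real set" and \<rho> \<gamma> :: real
  assumes finite_digits: "finite C" and nonempty_digits: "C \<noteq> {}"
    and ratio: "0 < \<rho>" "\<rho> < 1" and gap: "0 < \<gamma>"
    and digit_range: "\<And>c. c \<in> C \<Longrightarrow> 0 \<le> c \<and> c \<le> 1 - \<rho>"
    and separated: "\<And>c c'. c \<in> C \<Longrightarrow> c' \<in> C \<Longrightarrow> c \<noteq> c' \<Longrightarrow> \<rho> + \<gamma> \<le> \<bar>c - c'\<bar>"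
begin

section \<open>Addresses of the points of the self-similar set\<close>

definition code :: "(nat \<Rightarrow> real) \<Rightarrow> real" where
  "code \<omega> = (\<Sum>i. \<omega> i * \<rho> ^ i)"

lemma code_summable:
  assumes "range \<omega> \<subseteq> C"
  shows "summable (\<lambda>i. \<omega> i * \<rho> ^ i)"
proof (rule summable_comparison_test')
  show "summable (\<lambda>i. \<rho> ^ i)" using ratio by (simp add: summable_geometric)
  fix i :: nat
  have "\<omega> i \<in> C" using assms by auto
  then have "0 \<le> \<omega> i" "\<omega> i \<le> 1" using digit_range[of "\<omega> i"] ratio by auto
  then show "norm (\<omega> i * \<rho> ^ i) \<le> \<rho> ^ i"
    using ratio by (simp add: abs_mult mult_left_le_one_le)
qed

lemma code_Suc:
  assumes "range \<omega> \<subseteq> C"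
  shows "code \<omega> = \<omega> 0 + \<rho> * code (\<lambda>i. \<omega> (Suc i))"
proof -
  have 1: "range (\<lambda>i. \<omega> (Suc i)) \<subseteq> C" using assms by auto
  show ?thesis
    unfolding code_def
    using suminf_split_head[OF code_summable[OF assms]] suminf_mult[OF code_summable[OF 1], of \<rho>]
    by (simp add: algebra_simps)
qed

lemma code_range:
  assumes "range \<omega> \<subseteq> C"
  shows "0 \<le> code \<omega>" "code \<omega> \<le> 1"
proof -
  have r: "0 \<le> \<omega> i" "\<omega> i \<le> 1 - \<rho>" for i
    using digit_range[of "\<omega> i"] assms by auto
  show "0 \<le> code \<omega>"
    unfolding code_def using r ratio by (intro suminf_nonneg code_summable assms) auto
  have "code \<omega> \<le> (\<Sum>i. (1 - \<rho>) * \<rho> ^ i)"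
    unfolding code_def using r ratio
    by (intro suminf_le code_summable assms summable_mult summable_geometric mult_right_mono) auto
  also have "\<dots> = 1"
    using ratio by (simp add: suminf_mult suminf_geometric summable_geometric)
  finally show "code \<omega> \<le> 1" .
qed

text \<open>Addresses with a common prefix of length \<open>k\<close> lie in one copy of scale
  \<open>\<rho> ^ k\<close>, where the gap has shrunk to \<open>\<gamma> * \<rho> ^ k\<close>. At
  \<open>k = 0\<close> the digits differ by at least \<open>\<rho> + \<gamma>\<close>, of which the
  tails can undo at most \<open>\<rho>\<close>.\<close>

lemma code_separated:
  assumes "range \<omega> \<subseteq> C" "range \<omega>' \<subseteq> C" "\<And>i. i < k \<Longrightarrow> \<omega> i = \<omega>' i" "\<omega> k \<noteq> \<omega>' k"
  shows "\<gamma> * \<rho> ^ k \<le> \<bar>code \<omega> - code \<omega>'\<bar>"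
  using assms
proof (induction k arbitrary: \<omega> \<omega>')
  case 0
  let ?a = "code (\<lambda>i. \<omega> (Suc i))" and ?b = "code (\<lambda>i. \<omega>' (Suc i))"
  have sub: "range (\<lambda>i. \<omega> (Suc i)) \<subseteq> C" "range (\<lambda>i. \<omega>' (Suc i)) \<subseteq> C"
    using 0 by auto
  have "\<bar>?a - ?b\<bar> \<le> 1"
    using code_range[OF sub(1)] code_range[OF sub(2)] by auto
  then have "\<bar>\<rho> * ?a - \<rho> * ?b\<bar> \<le> \<rho>"
    using ratio by (simp add: abs_mult flip: right_diff_distrib)
  moreover have "\<rho> + \<gamma> \<le> \<bar>\<omega> 0 - \<omega>' 0\<bar>"
    using 0 by (intro separated) auto
  ultimately show ?case
    using code_Suc[OF 0(1)] code_Suc[OF 0(2)] by simp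
next
  case (Suc k)
  have "\<gamma> * \<rho> ^ k \<le> \<bar>code (\<lambda>i. \<omega> (Suc i)) - code (\<lambda>i. \<omega>' (Suc i))\<bar>"
    using Suc.prems by (intro Suc.IH) auto
  then have "\<rho> * (\<gamma> * \<rho> ^ k) \<le> \<rho> * \<bar>code (\<lambda>i. \<omega> (Suc i)) - code (\<lambda>i. \<omega>' (Suc i))\<bar>"
    using ratio by (intro mult_left_mono) auto
  also have "\<dots> = \<bar>code \<omega> - code \<omega>'\<bar>"
    using code_Suc[OF Suc.prems(1)] code_Suc[OF Suc.prems(2)] Suc.prems(3)[of 0] ratio
    by (simp add: abs_mult flip: right_diff_distrib)
  finally show ?case by (simp add: mult_ac)
qed

section \<open>The uniform measure on digit sequences\<close>

definition digit_measure :: "(nat \<Rightarrow> real) measure" where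
  "digit_measure = (\<Pi>\<^sub>M i\<in>UNIV. uniform_count_measure C)"

lemma space_digit_measure: "space digit_measure = {\<omega>. range \<omega> \<subseteq> C}"
  by (auto simp: digit_measure_def space_PiM space_uniform_count_measure PiE_def Pi_def)

lemma prob_space_digit_measure: "prob_space digit_measure"
  unfolding digit_measure_def
  by (intro prob_space_PiM prob_space_uniform_count_measure finite_digits nonempty_digits)

lemma cylinder:
  fixes n :: nat
  assumes "range \<omega> \<subseteq> C"
  defines "K \<equiv> {\<omega>'. range \<omega>' \<subseteq> C \<and> (\<forall>i<n. \<omega>' i = \<omega> i)}"
  shows "K \<in> sets digit_measure" "emeasure digit_measure K = ennreal (1 / real (card C) ^ n)"
proof -
  have K: "K = prod_emb UNIV (\<lambda>_. uniform_count_measure C) {..<n} (\<Pi>\<^sub>E i\<in>{..<n}. {\<omega> i})"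
  proof -
    have "prod_emb UNIV (\<lambda>_. uniform_count_measure C) {..<n} (\<Pi>\<^sub>E i\<in>{..<n}. {\<omega> i})
        = (\<Pi>\<^sub>E i\<in>UNIV. if i \<in> {..<n} then {\<omega> i} else space (uniform_count_measure C))"
      using assms(1) by (intro prod_emb_PiE) (auto simp: space_uniform_count_measure)
    also have "\<dots> = K"
      using assms(1)
      by (simp add: K_def PiE_UNIV_domain Pi_iff space_uniform_count_measure set_eq_iff
          image_subset_iff) (metis singletonD singletonI)
    finally show ?thesis by (rule sym)
  qed
  have s: "{\<omega> i} \<in> sets (uniform_count_measure C)" for i
    using assms by (auto simp: sets_uniform_count_measure)
  show "K \<in> sets digit_measure"
    unfolding K digit_measure_def using s by (intro sets_PiM_I) auto
  have "emeasure digit_measure K = (\<Prod>i<n. emeasure (uniform_count_measure C) {\<omega> i})"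
    unfolding K digit_measure_def using s
    by (intro emeasure_PiM_emb prob_space_uniform_count_measure finite_digits nonempty_digits) auto
  also have "\<dots> = (\<Prod>i<n. ennreal (1 / real (card C)))"
    using assms(1)
    by (intro prod.cong refl) (auto simp: emeasure_uniform_count_measure_if finite_digits)
  also have "\<dots> = ennreal (1 / real (card C) ^ n)"
    by (simp add: ennreal_power power_one_over)
  finally show "emeasure digit_measure K = ennreal (1 / real (card C) ^ n)" .
qed

section \<open>The mass distribution principle\<close>

definition digit_dim :: real where
  "digit_dim = ln (real (card C)) / ln (inverse \<rho>)"

lemma card_digits: "1 \<le> real (card C)"
  using finite_digits nonempty_digits by (simp add: Suc_le_eq card_gt_0_iff)

lemma digit_dim_nonneg: "0 \<le> digit_dim"
  unfolding digit_dim_def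
  using card_digits ratio by (intro divide_nonneg_pos ln_ge_zero ln_gt_zero) (auto simp: one_less_inverse)

text \<open>This identifies \<open>digit_dim\<close> as the similarity dimension: the mass of a
  cylinder of length \<open>n\<close> is its scale \<open>\<rho> ^ n\<close> to that power.\<close>

lemma ratio_powr_digit_dim: "(\<rho> ^ n) powr digit_dim = 1 / real (card C) ^ n"
proof -
  have "ln (\<rho> ^ n) * digit_dim = - (real n * ln (real (card C)))"
    using ratio by (simp add: digit_dim_def ln_inverse ln_realpow)
  then have "(\<rho> ^ n) powr digit_dim = exp (- (real n * ln (real (card C))))"
    using ratio by (simp add: powr_def mult.commute)
  also have "\<dots> = 1 / real (card C) ^ n"
    using card_digits by (simp add: exp_minus exp_of_nat_mult inverse_eq_divide)
  finally show ?thesis .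
qed

text \<open>The Frostman estimate. As \<open>U\<close> is arbitrary, its preimage under
  \<open>(x, \<omega>) -> (x, code \<omega>)\<close> is enclosed in a measurable set: an interval of
  length \<open>2 * d\<close> times a single cylinder.\<close>

lemma mass_bound:
  fixes U :: "(real \<times> real) set"
  assumes "bounded U"
  obtains K where "K \<in> sets (lborel \<Otimes>\<^sub>M digit_measure)"
    "{(x, \<omega>). range \<omega> \<subseteq> C \<and> (x, code \<omega>) \<in> U} \<subseteq> K"
    "emeasure (lborel \<Otimes>\<^sub>M digit_measure) K
       \<le> ennreal (2 / \<gamma> powr digit_dim * diameter U powr (1 + digit_dim))"
proof (cases "\<exists>x \<omega>. range \<omega> \<subseteq> C \<and> (x, code \<omega>) \<in> U")
  case False
  then show ?thesis by (intro that[of "{}"]) auto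
next
  case True
  then obtain x0 \<omega>0 where 0: "range \<omega>0 \<subseteq> C" "(x0, code \<omega>0) \<in> U" by auto
  interpret P: prob_space digit_measure by (rule prob_space_digit_measure)
  define d where "d = diameter U"
  have d0: "0 \<le> d" using assms by (simp add: d_def diameter_ge_0)
  have dist: "\<bar>x - x0\<bar> \<le> d" "\<bar>y - code \<omega>0\<bar> \<le> d" if "(x, y) \<in> U" for x y
  proof -
    have "dist (x, y) (x0, code \<omega>0) \<le> d"
      unfolding d_def using that 0 assms by (intro diameter_bounded_bound)
    then show "\<bar>x - x0\<bar> \<le> d" "\<bar>y - code \<omega>0\<bar> \<le> d"
      using dist_fst_le[of "(x, y)" "(x0, code \<omega>0)"] dist_snd_le[of "(x, y)" "(x0, code \<omega>0)"]
      by (auto simp: dist_real_def)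
  qed
  \<comment> \<open>For \<open>0 < d\<close> take the first level \<open>n\<close> whose gap is at
    most \<open>d\<close>. All earlier gaps exceed \<open>d\<close>, so the addresses of points in
    \<open>U\<close> agree up to \<open>n\<close>, while
    \<open>\<gamma> * \<rho> ^ n \<le> d\<close> bounds the mass of the cylinder. For
    \<open>d = 0\<close> the interval has length 0 and \<open>n = 0\<close> suffices.\<close>
  have "\<exists>n. (\<forall>k<n. d < \<gamma> * \<rho> ^ k) \<and> d * (1 / real (card C) ^ n) \<le> 1 / \<gamma> powr digit_dim * d powr (1 + digit_dim)"
  proof (cases "d = 0")
    case True
    then show ?thesis by (intro exI[of _ 0]) auto
  next
    case False
    with d0 have d: "0 < d" by simp
    have "(\<lambda>n. \<gamma> * \<rho> ^ n) \<longlonglongrightarrow> 0"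
      using ratio by (intro tendsto_mult_right_zero LIMSEQ_power_zero) auto
    from eventually_happens[OF order_tendstoD(2)[OF this d]]
    obtain m where "\<gamma> * \<rho> ^ m \<le> d" by (auto dest: less_imp_le)
    then have ex: "\<exists>n. \<gamma> * \<rho> ^ n \<le> d" ..
    define n where "n = (LEAST n. \<gamma> * \<rho> ^ n \<le> d)"
    have n: "\<gamma> * \<rho> ^ n \<le> d" unfolding n_def using ex by (rule LeastI_ex)
    have lt: "d < \<gamma> * \<rho> ^ k" if "k < n" for k
      using not_less_Least[of k "\<lambda>n. \<gamma> * \<rho> ^ n \<le> d"] that by (auto simp: n_def)
    have "1 / real (card C) ^ n = (\<rho> ^ n) powr digit_dim"
      by (simp add: ratio_powr_digit_dim)
    also have "\<dots> \<le> (d / \<gamma>) powr digit_dim"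
      using n gap ratio by (intro powr_mono2 digit_dim_nonneg) (auto simp: field_simps)
    also have "\<dots> = 1 / \<gamma> powr digit_dim * d powr digit_dim"
      using d gap by (simp add: powr_divide)
    finally have "d * (1 / real (card C) ^ n) \<le> d * (1 / \<gamma> powr digit_dim * d powr digit_dim)"
      using d by (intro mult_left_mono) auto
    then show ?thesis using lt d by (intro exI[of _ n]) (auto simp: powr_add)
  qed
  then obtain n where n: "\<And>k. k < n \<Longrightarrow> d < \<gamma> * \<rho> ^ k"
    and le: "d * (1 / real (card C) ^ n) \<le> 1 / \<gamma> powr digit_dim * d powr (1 + digit_dim)" by auto
  define K where "K = {\<omega>. range \<omega> \<subseteq> C \<and> (\<forall>i<n. \<omega> i = \<omega>0 i)}"
  note K = cylinder[OF 0(1), of n, folded K_def]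
  show ?thesis
  proof
    show "{x0 - d..x0 + d} \<times> K \<in> sets (lborel \<Otimes>\<^sub>M digit_measure)"
      using K by (intro pair_measureI) auto
    show "{(x, \<omega>). range \<omega> \<subseteq> C \<and> (x, code \<omega>) \<in> U} \<subseteq> {x0 - d..x0 + d} \<times> K"
    proof clarify
      fix x \<omega> assume w: "range \<omega> \<subseteq> C" "(x, code \<omega>) \<in> U"
      have "\<omega> i = \<omega>0 i" if "i < n" for i
      proof (rule ccontr)
        assume ne: "\<omega> i \<noteq> \<omega>0 i"
        define k where "k = (LEAST i. \<omega> i \<noteq> \<omega>0 i)"
        have k: "\<omega> k \<noteq> \<omega>0 k" unfolding k_def using ne by (rule LeastI)
        have "k \<le> i" unfolding k_def using ne by (rule Least_le)
        have "\<omega> j = \<omega>0 j" if "j < k" for j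
          using not_less_Least[of j "\<lambda>i. \<omega> i \<noteq> \<omega>0 i"] that by (auto simp: k_def)
        then have "\<gamma> * \<rho> ^ k \<le> \<bar>code \<omega> - code \<omega>0\<bar>"
          using k w(1) 0(1) by (intro code_separated)
        then show False
          using dist(2)[OF w(2)] n[of k] \<open>k \<le> i\<close> \<open>i < n\<close> by auto
      qed
      then show "x \<in> {x0 - d..x0 + d} \<and> \<omega> \<in> K"
        using w dist(1)[OF w(2)] by (auto simp: K_def)
    qed
    have "emeasure (lborel \<Otimes>\<^sub>M digit_measure) ({x0 - d..x0 + d} \<times> K)
        = emeasure lborel {x0 - d..x0 + d} * emeasure digit_measure K"
      using K by (intro P.emeasure_pair_measure_Times) auto
    also have "\<dots> = ennreal (2 * d * (1 / real (card C) ^ n))"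
      using d0 by (simp add: K(2) flip: ennreal_mult')
    also have "\<dots> \<le> ennreal (2 / \<gamma> powr digit_dim * diameter U powr (1 + digit_dim))"
      using le by (intro ennreal_leI) (simp add: d_def)
    finally show "emeasure (lborel \<Otimes>\<^sub>M digit_measure) ({x0 - d..x0 + d} \<times> K)
       \<le> ennreal (2 / \<gamma> powr digit_dim * diameter U powr (1 + digit_dim))" .
  qed
qed

text \<open>The enclosures of the sets \<open>U i\<close> together cover a set of mass 1. Each has
  mass at most \<open>2 / \<gamma> powr digit_dim\<close> times the weight of \<open>U i\<close>,
  whence the constant.\<close>

lemma hausdorff_weight_sum_ge:
  fixes A :: "(real \<times> real) set"
  assumes A: "\<And>x \<omega>. 0 < x \<Longrightarrow> x \<le> 1 \<Longrightarrow> range \<omega> \<subseteq> C \<Longrightarrow> (x, code \<omega>) \<in> A"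
    and s: "s \<le> 1 + digit_dim" and U: "U \<in> delta_covers 1 A"
  shows "ennreal (\<gamma> powr digit_dim / 2) \<le> (\<Sum>i. hausdorff_weight s (U i))"
proof -
  let ?M = "(lborel :: real measure) \<Otimes>\<^sub>M digit_measure"
  let ?c = "2 / \<gamma> powr digit_dim"
  interpret P: prob_space digit_measure by (rule prob_space_digit_measure)
  have bd: "bounded (U i)" "diameter (U i) \<le> 1" for i
    using U by (auto simp: delta_covers_def)
  have "\<exists>K. K \<in> sets ?M \<and> {(x, \<omega>). range \<omega> \<subseteq> C \<and> (x, code \<omega>) \<in> U i} \<subseteq> K \<and>
      emeasure ?M K \<le> ennreal (?c * diameter (U i) powr (1 + digit_dim))" for i
    by (rule mass_bound[OF bd(1)[of i]]) blast
  from choice[OF allI[OF this]] obtain K where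
    "\<forall>i. K i \<in> sets ?M \<and> {(x, \<omega>). range \<omega> \<subseteq> C \<and> (x, code \<omega>) \<in> U i} \<subseteq> K i \<and>
      emeasure ?M (K i) \<le> ennreal (?c * diameter (U i) powr (1 + digit_dim))" ..
  then have K: "K i \<in> sets ?M"
    "{(x, \<omega>). range \<omega> \<subseteq> C \<and> (x, code \<omega>) \<in> U i} \<subseteq> K i"
    "emeasure ?M (K i) \<le> ennreal (?c * diameter (U i) powr (1 + digit_dim))" for i
    by blast+
  \<comment> \<open>Here the mesh 1 matters: for diameters at most 1, lowering the exponent from
    \<open>1 + digit_dim\<close> to \<open>s\<close> can only raise the power.\<close>
  have weight: "ennreal (diameter (U i) powr (1 + digit_dim)) \<le> hausdorff_weight s (U i)" for i
  proof (cases "U i = {}")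
    case False
    have "diameter (U i) powr (1 + digit_dim) \<le> (if s = 0 then 1 else diameter (U i) powr s)"
      using bd[of i] s digit_dim_nonneg diameter_ge_0[OF bd(1), of i]
      by (auto intro!: powr_le1 powr_mono')
    then show ?thesis using False
      by (auto simp: hausdorff_weight_def intro!: ennreal_leI simp flip: ennreal_1 split: if_splits)
  qed simp
  have "{0<..1} \<times> space digit_measure \<subseteq> (\<Union>i. K i)"
  proof clarify
    fix x \<omega> assume "x \<in> {0<..1::real}" "\<omega> \<in> space digit_measure"
    then have w: "range \<omega> \<subseteq> C" "(x, code \<omega>) \<in> A"
      by (auto simp: space_digit_measure intro!: A)
    then obtain i where "(x, code \<omega>) \<in> U i" using U by (auto simp: delta_covers_def)
    then show "(x, \<omega>) \<in> (\<Union>i. K i)" using w K(2)[of i] by auto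
  qed
  then have "emeasure ?M ({0<..1} \<times> space digit_measure) \<le> emeasure ?M (\<Union>i. K i)"
    by (rule emeasure_mono) (intro sets.countable_UN K image_subsetI)
  also have "\<dots> \<le> (\<Sum>i. emeasure ?M (K i))"
    by (intro emeasure_subadditive_countably image_subsetI K)
  also have "\<dots> \<le> (\<Sum>i. ennreal ?c * hausdorff_weight s (U i))"
  proof (intro suminf_le)
    fix i
    have "emeasure ?M (K i) \<le> ennreal ?c * ennreal (diameter (U i) powr (1 + digit_dim))"
      using K(3)[of i] by (subst ennreal_mult[symmetric]) auto
    also have "\<dots> \<le> ennreal ?c * hausdorff_weight s (U i)"
      by (intro mult_left_mono weight) auto
    finally show "emeasure ?M (K i) \<le> ennreal ?c * hausdorff_weight s (U i)" .
  qed auto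
  also have "\<dots> = ennreal ?c * (\<Sum>i. hausdorff_weight s (U i))"
    by simp
  finally have le: "1 \<le> ennreal ?c * (\<Sum>i. hausdorff_weight s (U i))"
    by (simp add: P.emeasure_pair_measure_Times P.emeasure_space_1)
  show ?thesis
  proof (cases "\<Sum>i. hausdorff_weight s (U i)")
    case (real r)
    then have "ennreal 1 \<le> ennreal (?c * r)" using le by (subst ennreal_mult) auto
    then have "1 \<le> ?c * r" using real(1) by (subst (asm) ennreal_le_iff) auto
    then show ?thesis unfolding real(2) using gap by (intro ennreal_leI) (simp add: field_simps)
  qed simp
qed

text \<open>The inequality is strict because the bound on weight sums holds at the critical exponent
  itself, where the measure is thus still positive.\<close>

lemma hausdorff_measure_zero_imp:
  fixes A :: "(real \<times> real) set"
  assumes A: "\<And>x \<omega>. 0 < x \<Longrightarrow> x \<le> 1 \<Longrightarrow> range \<omega> \<subseteq> C \<Longrightarrow> (x, code \<omega>) \<in> A"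
    and zero: "hausdorff_measure s A = 0"
  shows "1 + digit_dim < s"
proof (rule ccontr)
  assume "\<not> 1 + digit_dim < s"
  then have "ennreal (\<gamma> powr digit_dim / 2) \<le> hausdorff_premeasure s 1 A"
    unfolding hausdorff_premeasure_def using A by (intro INF_greatest hausdorff_weight_sum_ge) auto
  also have "\<dots> \<le> hausdorff_measure s A"
    unfolding hausdorff_measure_def by (intro SUP_upper) auto
  finally show False using zero gap by (simp add: ennreal_le_iff2 not_le)
qed

end

section \<open>The strips of the iterated baker map\<close>

definition words :: "nat \<Rightarrow> bool list set" where
  "words n = {w. length w = n}"

lemma words_0: "words 0 = {[]}"
  by (auto simp: words_def)

lemma words_Suc: "words (Suc n) = Cons False ` words n \<union> Cons True ` words n"
  by (auto simp: words_def length_Suc_conv)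

lemma finite_words: "finite (words n)"
  by (induction n) (auto simp: words_0 words_Suc)

lemma sum_words_Suc:
  "sum f (words (Suc n)) = (\<Sum>w\<in>words n. f (False # w)) + (\<Sum>w\<in>words n. f (True # w))"
  unfolding words_Suc
  by (subst sum.union_disjoint) (auto simp: finite_words sum.reindex)

lemma card_words: "card (words n) = 2 ^ n"
proof (induction n)
  case (Suc n)
  then show ?case using sum_words_Suc[of "\<lambda>_. 1::nat" n] by simp
qed (simp add: words_0)

locale baker =
  fixes \<beta> \<tau> :: real
  assumes beta: "1 < \<beta>" "\<beta> < 2" and tau: "0 < \<tau>" "\<tau> < 1 / 2"
begin

text \<open>
  The head of a word is the most recent digit. Up to its left edge, the strip
  \<open>{0<..width w} \<times> {pos w..pos w + \<tau> ^ length w}\<close> is the image of the cylinder of \<open>w\<close>; words that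
  are not admissible get width 0.
\<close>
fun width :: "bool list \<Rightarrow> real" where
  "width [] = 1"
| "width (False # w) = min 1 (\<beta> * width w)"
| "width (True # w) = max 0 (\<beta> * width w - 1)"

fun pos :: "bool list \<Rightarrow> real" where
  "pos [] = 0"
| "pos (False # w) = \<tau> * pos w"
| "pos (True # w) = \<tau> * pos w + (1 - \<tau>)"

lemma width_range: "0 \<le> width w" "width w \<le> 1"
proof (induction w rule: width.induct)
  case (3 w)
  { case 2
    have "\<beta> * width w \<le> \<beta>" using 3 beta by (simp add: mult_left_le)
    then have "\<beta> * width w - 1 \<le> 1" using beta by linarith
    then show ?case by simp }
qed (use beta in auto)

lemma pos_range: "0 \<le> pos w" "pos w \<le> 1 - \<tau> ^ length w"
proof (induction w rule: pos.induct)
  case (2 w)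
  { case 2
    have "\<tau> * pos w \<le> \<tau> * (1 - \<tau> ^ length w)" using 2 tau by (intro mult_left_mono) (auto intro: "2.IH")
    then show ?case using tau by (simp add: algebra_simps) }
next
  case (3 w)
  { case 2
    have "\<tau> * pos w \<le> \<tau> * (1 - \<tau> ^ length w)" using 3 tau by (intro mult_left_mono) auto
    then show ?case using tau by (simp add: algebra_simps) }
qed (use tau in auto)

text \<open>The head is the outermost map: different heads put the strips into the bottom and top
  bands of height \<open>\<tau>\<close>, which are \<open>1 - 2 * \<tau>\<close> apart, and a common
  head scales distances by \<open>\<tau>\<close>. The bound is written as strip height plus gap, the
  form required by \<open>separated_digits\<close>.\<close>

lemma pos_separated:
  assumes "length u = length v" "u \<noteq> v"
  shows "\<tau> ^ length u + (1 - 2 * \<tau>) * \<tau> ^ length u \<le> \<bar>pos u - pos v\<bar>"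
  using assms
proof (induction u v rule: list_induct2)
  case (Cons a u b v)
  show ?case
  proof (cases "a = b")
    case True
    then have "\<tau> ^ length u + (1 - 2 * \<tau>) * \<tau> ^ length u \<le> \<bar>pos u - pos v\<bar>"
      using Cons by simp
    then have "\<tau> * (\<tau> ^ length u + (1 - 2 * \<tau>) * \<tau> ^ length u) \<le> \<tau> * \<bar>pos u - pos v\<bar>"
      using tau by (intro mult_left_mono) auto
    also have "\<dots> = \<bar>\<tau> * pos u - \<tau> * pos v\<bar>"
      using tau by (simp add: abs_mult flip: right_diff_distrib)
    also have "\<dots> = \<bar>pos (a # u) - pos (b # v)\<bar>"
      using True by (cases a) auto
    finally show ?thesis by (simp add: algebra_simps)
  next
    case False
    have range: "0 \<le> \<tau> * pos w" "\<tau> * pos w \<le> \<tau> * (1 - \<tau> ^ length w)" for w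
      using pos_range[of w] tau by (auto intro!: mult_left_mono)
    have "(1 - 2 * \<tau>) * \<tau> ^ Suc (length u) \<le> 1 - 2 * \<tau>"
      using tau by (intro mult_left_le power_le_one) auto
    then show ?thesis
      using range[of u] range[of v] False Cons.hyps
      by (cases a; cases b) (auto simp: algebra_simps)
  qed
qed simp

text \<open>With \<open>t = \<beta> * width w\<close>, the two children of \<open>w\<close> have
  widths \<open>min 1 t\<close> and \<open>max 0 (t - 1)\<close>, which add up to
  \<open>t\<close>.\<close>

lemma sum_width: "(\<Sum>w\<in>words n. width w) = \<beta> ^ n"
proof (induction n)
  case (Suc n)
  have "(\<Sum>w\<in>words (Suc n). width w) = (\<Sum>w\<in>words n. min 1 (\<beta> * width w) + max 0 (\<beta> * width w - 1))"
    by (simp add: sum_words_Suc sum.distrib)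
  also have "\<dots> = (\<Sum>w\<in>words n. \<beta> * width w)"
    by (intro sum.cong) auto
  finally show ?case using Suc by (simp flip: sum_distrib_left)
qed (simp add: words_0)

subsection \<open>Upper bound\<close>

text \<open>The strips are taken closed, degenerate ones included, so that the inclusion survives
  the closure in the definition of the attractor.\<close>

lemma iterate_subset_strips:
  "(baker_map \<beta> \<tau> ^^ n) ` unit_square \<subseteq>
     (\<Union>w\<in>words n. {0..width w} \<times> {pos w..pos w + \<tau> ^ n})"
proof (induction n)
  case (Suc n)
  have "(baker_map \<beta> \<tau> ^^ Suc n) ` unit_square = baker_map \<beta> \<tau> ` ((baker_map \<beta> \<tau> ^^ n) ` unit_square)"
    by (simp add: image_comp)
  also have "\<dots> \<subseteq> (\<Union>w\<in>words (Suc n). {0..width w} \<times> {pos w..pos w + \<tau> ^ Suc n})"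
  proof
    fix q assume "q \<in> baker_map \<beta> \<tau> ` ((baker_map \<beta> \<tau> ^^ n) ` unit_square)"
    then obtain p where p: "q = baker_map \<beta> \<tau> p"
      and "p \<in> (baker_map \<beta> \<tau> ^^ n) ` unit_square"
      by (rule imageE)
    from subsetD[OF Suc.IH this(2)] obtain w where w: "w \<in> words n"
      and pw: "p \<in> {0..width w} \<times> {pos w..pos w + \<tau> ^ n}"
      by (rule UN_E)
    obtain x y where q: "q = baker_map \<beta> \<tau> (x, y)"
      and xy: "0 \<le> x" "x \<le> width w" "pos w \<le> y" "y \<le> pos w + \<tau> ^ n"
      using p pw by (cases p) simp
    have y: "\<tau> * pos w \<le> \<tau> * y" "\<tau> * y \<le> \<tau> * (pos w + \<tau> ^ n)"
      using xy tau by auto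
    have x: "\<beta> * x \<le> \<beta> * width w" "0 \<le> \<beta> * x" using xy beta by auto
    have c: "x \<le> inverse \<beta> \<longleftrightarrow> \<beta> * x \<le> 1" using beta by (simp add: field_simps)
    show "q \<in> (\<Union>w\<in>words (Suc n). {0..width w} \<times> {pos w..pos w + \<tau> ^ Suc n})"
    proof (cases "\<beta> * x \<le> 1")
      case True
      then have "q \<in> {0..width (False # w)} \<times> {pos (False # w)..pos (False # w) + \<tau> ^ Suc n}"
        using x y c by (auto simp: q baker_map_def algebra_simps)
      then show ?thesis using w by (intro UN_I[of "False # w"]) (auto simp: words_Suc)
    next
      case False
      then have "q \<in> {0..width (True # w)} \<times> {pos (True # w)..pos (True # w) + \<tau> ^ Suc n}"
        using x y c by (auto simp: q baker_map_def algebra_simps)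
      then show ?thesis using w by (intro UN_I[of "True # w"]) (auto simp: words_Suc)
    qed
  qed
  finally show ?case .
qed (simp add: words_0)

lemma attractor_subset_strips:
  "baker_attractor \<beta> \<tau> \<subseteq> (\<Union>w\<in>words n. {0..width w} \<times> {pos w..pos w + \<tau> ^ n})"
  unfolding baker_attractor_def
proof (rule closure_minimal)
  show "(\<Inter>i. (baker_map \<beta> \<tau> ^^ i) ` unit_square)
      \<subseteq> (\<Union>w\<in>words n. {0..width w} \<times> {pos w..pos w + \<tau> ^ n})"
    using iterate_subset_strips[of n] by blast
  show "closed (\<Union>w\<in>words n. {0..width w} \<times> {pos w..pos w + \<tau> ^ n})"
    by (intro closed_UN finite_words ballI closed_Times closed_atLeastAtMost)
qed

text \<open>About \<open>(\<beta> / \<tau>) ^ n\<close> squares of side \<open>\<tau> ^ n\<close>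
  are used. One factor 2 pays for the excess squares at the strip ends; \<open>2 powr s\<close>
  comes from bounding the diameter of a square by the sum of its two sides.\<close>

lemma premeasure_attractor_le:
  assumes "0 < s" "2 * \<tau> ^ n \<le> \<delta>"
  shows "hausdorff_premeasure s \<delta> (baker_attractor \<beta> \<tau>)
    \<le> ennreal (2 * 2 powr s * (\<beta> * \<tau> powr (s - 1)) ^ n)"
proof -
  define e where "e = \<tau> ^ n"
  have e: "0 < e" using tau by (simp add: e_def)
  define cell :: "bool list \<times> nat \<Rightarrow> (real \<times> real) set"
    where "cell = (\<lambda>(w, k). {real k * e..real k * e + e} \<times> {pos w..pos w + e})"
  \<comment> \<open>The indices include the floor itself, so the last square may stick out of the
    strip; this costs one extra square per word.\<close>
  define I where "I = (SIGMA w:words n. {..nat \<lfloor>width w / e\<rfloor>})"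
  have finI: "finite I" by (auto simp: I_def finite_words)
  have "real (card I) = (\<Sum>w\<in>words n. real (nat \<lfloor>width w / e\<rfloor>) + 1)"
    by (simp add: I_def finite_words add.commute)
  also have "\<dots> \<le> (\<Sum>w\<in>words n. width w / e + 1)"
    using width_range e by (intro sum_mono) (auto simp: divide_nonneg_pos)
  also have "\<dots> = \<beta> ^ n / e + 2 ^ n"
    by (simp add: sum.distrib sum_width card_words flip: sum_divide_distrib)
  \<comment> \<open>The extra squares number \<open>2 ^ n\<close>; they are absorbed because
    \<open>2 * \<tau> < 1 < \<beta>\<close>.\<close>
  also have "2 ^ n \<le> (\<beta> / \<tau>) ^ n"
  proof (rule power_mono)
    have "2 * \<tau> \<le> \<beta>" using beta tau by simp
    then show "2 \<le> \<beta> / \<tau>" using tau by (simp add: field_simps)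
  qed simp
  finally have card: "real (card I) \<le> 2 * (\<beta> ^ n / e)"
    by (simp add: e_def power_divide)
  have cells: "bounded (cell i) \<and> diameter (cell i) \<le> 2 * e" for i
  proof -
    obtain w k where i: "i = (w, k)" by force
    have "diameter (cell i) \<le> 2 * e"
    proof (rule diameter_le)
      fix p q assume "p \<in> cell i" "q \<in> cell i"
      then have "\<bar>fst p - fst q\<bar> \<le> e" "\<bar>snd p - snd q\<bar> \<le> e"
        by (auto simp: cell_def i)
      then show "norm (p - q) \<le> 2 * e"
        using sqrt_sum_squares_le_sum_abs[of "fst p - fst q" "snd p - snd q"]
        by (simp add: norm_prod_def)
    qed (use e in auto)
    then show ?thesis by (auto simp: cell_def i intro!: bounded_Times)
  qed
  have cover: "baker_attractor \<beta> \<tau> \<subseteq> \<Union>(cell ` I)"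
  proof
    fix p assume "p \<in> baker_attractor \<beta> \<tau>"
    then have "p \<in> (\<Union>w\<in>words n. {0..width w} \<times> {pos w..pos w + e})"
      unfolding e_def using attractor_subset_strips by (rule subsetD[rotated])
    then obtain w where "w \<in> words n" "p \<in> {0..width w} \<times> {pos w..pos w + e}"
      by (rule UN_E)
    then obtain x y where p: "p = (x, y)" "w \<in> words n" "0 \<le> x" "x \<le> width w"
      "pos w \<le> y" "y \<le> pos w + e"
      by (cases p) simp
    define k where "k = nat \<lfloor>x / e\<rfloor>"
    have "x / e \<le> width w / e" using p e by (simp add: divide_right_mono)
    then have "k \<le> nat \<lfloor>width w / e\<rfloor>" unfolding k_def by (intro nat_mono floor_mono)
    then have "(w, k) \<in> I" using p by (auto simp: I_def)
    moreover have "real k \<le> x / e" "x / e \<le> real k + 1"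
      using p e by (auto simp: k_def divide_nonneg_pos intro: less_imp_le real_of_int_floor_add_one_gt)
    then have "p \<in> cell (w, k)" using p e by (auto simp: cell_def field_simps)
    ultimately show "p \<in> \<Union>(cell ` I)" by blast
  qed
  have "hausdorff_premeasure s \<delta> (baker_attractor \<beta> \<tau>) \<le> ennreal (real (card (cell ` I)) * (2 * e) powr s)"
    using finI cover cells assms e
    by (intro hausdorff_premeasure_le_card) (auto simp: e_def)
  also have "\<dots> \<le> ennreal (2 * (\<beta> ^ n / e) * (2 * e) powr s)"
  proof (intro ennreal_leI mult_right_mono)
    show "real (card (cell ` I)) \<le> 2 * (\<beta> ^ n / e)"
      using card card_image_le[OF finI, of cell] by linarith
  qed auto
  also have "2 * (\<beta> ^ n / e) * (2 * e) powr s = 2 * 2 powr s * (\<beta> ^ n * e powr (s - 1))"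
    using e by (simp add: powr_mult powr_diff field_simps)
  also have "e powr (s - 1) = (\<tau> powr (s - 1)) ^ n"
    using tau by (simp add: e_def powr_powr mult.commute flip: powr_realpow)
  finally show ?thesis by (simp add: power_mult_distrib)
qed

text \<open>The hypothesis makes the ratio \<open>q\<close> of the preceding bound smaller than 1.
  For fixed \<open>\<delta>\<close> that bound applies at all large \<open>n\<close>, so the
  premeasure vanishes.\<close>

lemma hausdorff_measure_attractor_zero:
  assumes s: "1 + ln \<beta> / ln (inverse \<tau>) < s"
  shows "hausdorff_measure s (baker_attractor \<beta> \<tau>) = 0"
proof -
  have lt: "0 < ln (inverse \<tau>)" using tau by (simp add: ln_inverse)
  have "0 < ln \<beta> / ln (inverse \<tau>)" using beta lt by simp
  then have s0: "0 < s" using s by simp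
  define q where "q = \<beta> * \<tau> powr (s - 1)"
  have "ln \<beta> < (s - 1) * ln (inverse \<tau>)" using s lt by (simp add: field_simps)
  then have "ln q < 0" using beta tau by (simp add: q_def ln_mult ln_powr ln_inverse)
  moreover have q0: "0 < q" using beta tau by (simp add: q_def)
  ultimately have q1: "q < 1" by simp
  have "hausdorff_premeasure s \<delta> (baker_attractor \<beta> \<tau>) = 0" if "0 < \<delta>" for \<delta>
  proof -
    have "(\<lambda>n. 2 * \<tau> ^ n) \<longlonglongrightarrow> 0"
      using tau by (intro tendsto_mult_right_zero LIMSEQ_power_zero) auto
    then have ev: "\<forall>\<^sub>F n in sequentially. 2 * \<tau> ^ n < \<delta>"
      using that by (rule order_tendstoD)
    have "(\<lambda>n. 2 * 2 powr s * q ^ n) \<longlonglongrightarrow> 0"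
      using q0 q1 by (intro tendsto_mult_right_zero LIMSEQ_power_zero) auto
    then have "(\<lambda>n. ennreal (2 * 2 powr s * q ^ n)) \<longlonglongrightarrow> ennreal 0"
      by (rule tendsto_ennrealI)
    moreover have "\<forall>\<^sub>F n in sequentially.
        hausdorff_premeasure s \<delta> (baker_attractor \<beta> \<tau>) \<le> ennreal (2 * 2 powr s * q ^ n)"
      using ev unfolding q_def
      by eventually_elim (intro premeasure_attractor_le s0, simp)
    ultimately have "hausdorff_premeasure s \<delta> (baker_attractor \<beta> \<tau>) \<le> ennreal 0"
      by (intro tendsto_lowerbound) auto
    then show ?thesis by simp
  qed
  then show ?thesis by (auto simp: hausdorff_measure_def)
qed

subsection \<open>Lower bound\<close>

definition full_words :: "nat \<Rightarrow> bool list set" where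
  "full_words n = {w \<in> words n. width w = 1}"

definition partial_words :: "nat \<Rightarrow> bool list set" where
  "partial_words n = {w \<in> words n. 0 < width w \<and> width w < 1}"

lemma finite_full_words: "finite (full_words n)"
  and finite_partial_words: "finite (partial_words n)"
  by (auto simp: full_words_def partial_words_def finite_words)

lemma card_full_words_mono: "card (full_words n) \<le> card (full_words (Suc n))"
proof (rule card_inj_on_le)
  show "Cons False ` full_words n \<subseteq> full_words (Suc n)"
    using beta by (auto simp: full_words_def words_Suc)
qed (auto simp: finite_full_words)

text \<open>A partial \<open>False\<close> child has a partial parent. A partial \<open>True\<close>
  child arises only when its parent splits, and then its \<open>False\<close> sibling is full; so
  children of this kind are no more numerous than the full words of the new level.\<close>

lemma card_partial_words_Suc:
  "card (partial_words (Suc n)) \<le> card (partial_words n) + card (full_words (Suc n))"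
proof -
  let ?T = "{w \<in> words n. 1 < \<beta> * width w}"
  have fin: "finite ?T" by (simp add: finite_words)
  have "partial_words (Suc n) \<subseteq> Cons False ` partial_words n \<union> Cons True ` ?T"
  proof
    fix v assume "v \<in> partial_words (Suc n)"
    then obtain a w where v: "v = a # w" "w \<in> words n" "0 < width (a # w)" "width (a # w) < 1"
      by (auto simp: partial_words_def words_Suc)
    show "v \<in> Cons False ` partial_words n \<union> Cons True ` ?T"
    proof (cases a)
      case True
      then show ?thesis using v by auto
    next
      case False
      then have "\<beta> * width w < 1" "0 < \<beta> * width w" using v by auto
      then have "width w \<noteq> 1" "0 < width w" using beta by (auto simp: zero_less_mult_iff)
      then have "w \<in> partial_words n"
        using v width_range[of w] by (auto simp: partial_words_def)
      then show ?thesis using False v by auto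
    qed
  qed
  then have "card (partial_words (Suc n)) \<le> card (Cons False ` partial_words n \<union> Cons True ` ?T)"
    using fin by (intro card_mono) (auto simp: finite_partial_words)
  also have "\<dots> \<le> card (Cons False ` partial_words n) + card (Cons True ` ?T)"
    by (rule card_Un_le)
  also have "\<dots> \<le> card (partial_words n) + card ?T"
    using fin by (intro add_mono card_image_le finite_partial_words) auto
  also have "card ?T \<le> card (full_words (Suc n))"
  proof (rule card_inj_on_le)
    show "Cons False ` ?T \<subseteq> full_words (Suc n)"
      by (auto simp: full_words_def words_Suc)
  qed (auto simp: finite_full_words)
  finally show ?thesis by simp
qed

text \<open>Each level adds at most as many partial words as it has full ones, and the number of
  full words never decreases.\<close>

lemma card_partial_words_le: "card (partial_words n) \<le> n * card (full_words n)"
proof (induction n)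
  case 0
  have "partial_words 0 = {}" by (auto simp: partial_words_def words_0)
  then show ?case by simp
next
  case (Suc n)
  have "card (partial_words (Suc n)) \<le> n * card (full_words n) + card (full_words (Suc n))"
    using Suc card_partial_words_Suc[of n] by linarith
  also have "\<dots> \<le> n * card (full_words (Suc n)) + card (full_words (Suc n))"
    using card_full_words_mono[of n] by simp
  finally show ?case by simp
qed

text \<open>Words of width 0 add nothing to the total width \<open>\<beta> ^ n\<close>, and every
  other word adds at most 1.\<close>

lemma card_full_words_ge: "\<beta> ^ n \<le> (real n + 1) * real (card (full_words n))"
proof -
  have "\<beta> ^ n = (\<Sum>w\<in>words n. width w)" by (simp add: sum_width)
  also have "\<dots> = (\<Sum>w\<in>full_words n \<union> partial_words n. width w)"
    using width_range
    by (intro sum.mono_neutral_right finite_words)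
       (auto simp: full_words_def partial_words_def not_less intro: antisym)
  also have "\<dots> \<le> real (card (full_words n \<union> partial_words n)) * 1"
    by (intro sum_bounded_above width_range)
  also have "\<dots> \<le> real (card (full_words n) + card (partial_words n))"
    using card_Un_le[of "full_words n" "partial_words n"] by simp
  also have "\<dots> \<le> real (card (full_words n) + n * card (full_words n))"
    using card_partial_words_le[of n] by (simp only: of_nat_le_iff add_le_cancel_left)
  finally show ?thesis by (simp add: algebra_simps)
qed

section \<open>Full words inside the attractor\<close>

lemma strip_preimage:
  assumes "0 < x" "x \<le> width w"
  shows "\<exists>x'. 0 < x' \<and> x' \<le> 1 \<and> (\<forall>y. (baker_map \<beta> \<tau> ^^ length w) (x', y) = (x, pos w + \<tau> ^ length w * y))"
  using assms
proof (induction w arbitrary: x)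
  case Nil
  then show ?case by (intro exI[of _ x]) auto
next
  case (Cons a w)
  \<comment> \<open>This inverts the branch named by the head digit. The branch depends on the first
    coordinate alone, so one \<open>x'\<close> serves every \<open>y\<close>. For the head
    \<open>True\<close>, \<open>0 < x\<close> is what puts \<open>z\<close> strictly to the right of
    \<open>inverse \<beta>\<close>; hence the left edge is excluded.\<close>
  define z where "z = (if a then x + 1 else x) / \<beta>"
  have z: "0 < z" "z \<le> width w"
    using Cons.prems beta by (cases a; auto simp: z_def field_simps)+
  have bx: "\<not> \<beta> * x \<le> 0"
    using Cons.prems beta by (simp add: mult_le_0_iff)
  have map: "baker_map \<beta> \<tau> (z, y) = (x, if a then \<tau> * y + (1 - \<tau>) else \<tau> * y)" for y
    using Cons.prems beta bx by (cases a) (auto simp: baker_map_def z_def field_simps)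
  obtain x' where "0 < x'" "x' \<le> 1"
    "\<And>y. (baker_map \<beta> \<tau> ^^ length w) (x', y) = (z, pos w + \<tau> ^ length w * y)"
    using Cons.IH[OF z] by blast
  then show ?case
    by (intro exI[of _ x']) (cases a; auto simp: map algebra_simps)
qed

text \<open>This allows membership in all iterates to be checked only at multiples of a block
  length.\<close>

lemma iterate_antimono:
  assumes "m \<le> n"
  shows "(baker_map \<beta> \<tau> ^^ n) ` unit_square \<subseteq> (baker_map \<beta> \<tau> ^^ m) ` unit_square"
  using assms
proof (induction n rule: dec_induct)
  case (step n)
  have "(baker_map \<beta> \<tau> ^^ Suc n) ` unit_square = (baker_map \<beta> \<tau> ^^ n) ` (baker_map \<beta> \<tau> ` unit_square)"
    by (simp add: funpow_Suc_right image_comp del: funpow.simps)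
  also have "\<dots> \<subseteq> (baker_map \<beta> \<tau> ^^ n) ` unit_square"
    using baker_map_unit_square[OF beta tau] by (rule image_mono)
  finally show ?case using step by blast
qed simp

text \<open>Following a full word \<open>w\<close> for \<open>n\<close> steps acts on the second
  coordinate as \<open>y -> pos w + \<tau> ^ n * y\<close>, so the positions are the digits. Full
  words exist because \<open>card_full_words_ge\<close> bounds their number below by a positive
  quantity.\<close>

lemma separated_digits_full_words:
  assumes "0 < n"
  shows "separated_digits (pos ` full_words n) (\<tau> ^ n) ((1 - 2 * \<tau>) * \<tau> ^ n)"
proof
  have "\<beta> ^ n > 0" using beta by simp
  then have "full_words n \<noteq> {}"
    using card_full_words_ge[of n] by (auto simp: not_le)
  then show "pos ` full_words n \<noteq> {}" by simp
  show "\<tau> ^ n < 1" using tau assms by (simp add: power_less_one_iff)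
  show "0 \<le> c \<and> c \<le> 1 - \<tau> ^ n" if "c \<in> pos ` full_words n" for c
    using that pos_range by (auto simp: full_words_def words_def)
  show "\<tau> ^ n + (1 - 2 * \<tau>) * \<tau> ^ n \<le> \<bar>c - c'\<bar>"
    if "c \<in> pos ` full_words n" "c' \<in> pos ` full_words n" "c \<noteq> c'" for c c'
    using that pos_separated by (fastforce simp: full_words_def words_def)
qed (use tau in \<open>auto simp: finite_full_words\<close>)

lemma card_pos_full_words: "card (pos ` full_words n) = card (full_words n)"
proof (rule card_image, rule inj_onI, rule ccontr)
  fix u v assume uv: "u \<in> full_words n" "v \<in> full_words n" "pos u = pos v" "u \<noteq> v"
  then have "\<tau> ^ n + (1 - 2 * \<tau>) * \<tau> ^ n \<le> 0"
    using pos_separated[of u v] by (auto simp: full_words_def words_def)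
  moreover have "0 < \<tau> ^ n + (1 - 2 * \<tau>) * \<tau> ^ n"
    using tau by (intro add_pos_pos mult_pos_pos) auto
  ultimately show False by simp
qed

text \<open>The first word has width 1, so every \<open>x\<close> in \<open>{0<..1}\<close> can be
  pulled back along it to a point of the same interval. The shifted sequence can then be treated in
  the same way, indefinitely.\<close>

lemma segment_times_code_subset_attractor:
  assumes n: "0 < n" and x: "0 < x" "x \<le> 1" and \<omega>: "range \<omega> \<subseteq> pos ` full_words n"
  shows "(x, separated_digits.code (\<tau> ^ n) \<omega>) \<in> baker_attractor \<beta> \<tau>"
proof -
  interpret D: separated_digits "pos ` full_words n" "\<tau> ^ n" "(1 - 2 * \<tau>) * \<tau> ^ n"
    using n by (rule separated_digits_full_words)
  have iter: "(x, D.code \<omega>) \<in> (baker_map \<beta> \<tau> ^^ (n * k)) ` unit_square"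
    if "0 < x" "x \<le> 1" "range \<omega> \<subseteq> pos ` full_words n" for x \<omega> k
    using that
  proof (induction k arbitrary: x \<omega>)
    case 0
    then show ?case using D.code_range[OF 0(3)] by simp
  next
    case (Suc k)
    obtain w where w: "w \<in> full_words n" "\<omega> 0 = pos w" using Suc.prems by auto
    have len: "length w = n" "width w = 1" using w by (auto simp: full_words_def words_def)
    obtain x' where x': "0 < x'" "x' \<le> 1"
      "\<And>y. (baker_map \<beta> \<tau> ^^ n) (x', y) = (x, pos w + \<tau> ^ n * y)"
      using strip_preimage[of x w] Suc.prems len by auto
    have "(x', D.code (\<lambda>i. \<omega> (Suc i))) \<in> (baker_map \<beta> \<tau> ^^ (n * k)) ` unit_square"
      using x' Suc.prems by (intro Suc.IH) auto
    moreover have "(baker_map \<beta> \<tau> ^^ n) (x', D.code (\<lambda>i. \<omega> (Suc i))) = (x, D.code \<omega>)"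
      using x'(3) D.code_Suc[OF Suc.prems(3)] w by simp
    ultimately have "(x, D.code \<omega>) \<in> (baker_map \<beta> \<tau> ^^ n) ` (baker_map \<beta> \<tau> ^^ (n * k)) ` unit_square"
      by (metis imageI)
    then show ?case by (simp add: funpow_add image_comp)
  qed
  have "(x, D.code \<omega>) \<in> (baker_map \<beta> \<tau> ^^ k) ` unit_square" for k
    using iter[OF x \<omega>, of k] iterate_antimono[of k "n * k"] n by auto
  then show ?thesis
    unfolding baker_attractor_def by (intro subsetD[OF closure_subset]) auto
qed

text \<open>The factor \<open>n + 1\<close> in \<open>card_full_words_ge\<close> costs blocks of
  length \<open>n\<close> only \<open>ln (real n + 1) / real n\<close>, which vanishes in the
  limit.\<close>

lemma hausdorff_measure_attractor_zero_imp:
  assumes zero: "hausdorff_measure s (baker_attractor \<beta> \<tau>) = 0"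
  shows "1 + ln \<beta> / ln (inverse \<tau>) \<le> s"
proof -
  define l where "l = ln (inverse \<tau>)"
  have l: "0 < l" using tau by (simp add: l_def ln_inverse)
  have ge: "1 + (ln \<beta> - ln (real n + 1) / real n) / l \<le> s" if n: "0 < n" for n
  proof -
    interpret D: separated_digits "pos ` full_words n" "\<tau> ^ n" "(1 - 2 * \<tau>) * \<tau> ^ n"
      using n by (rule separated_digits_full_words)
    let ?F = "real (card (full_words n))"
    have F: "1 \<le> ?F" using D.card_digits by (simp add: card_pos_full_words)
    have "ln (\<beta> ^ n) \<le> ln ((real n + 1) * ?F)"
      using card_full_words_ge[of n] beta F by (subst ln_le_cancel_iff) auto
    then have "real n * ln \<beta> \<le> ln (real n + 1) + ln ?F"
      using beta F by (simp add: ln_realpow ln_mult)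
    then have "ln \<beta> \<le> (ln (real n + 1) + ln ?F) / real n"
      using n by (simp add: pos_le_divide_eq mult.commute)
    then have "ln \<beta> - ln (real n + 1) / real n \<le> ln ?F / real n"
      by (simp add: add_divide_distrib)
    then have "(ln \<beta> - ln (real n + 1) / real n) / l \<le> ln ?F / real n / l"
      using l by (intro divide_right_mono) auto
    also have "\<dots> = D.digit_dim"
      using tau by (simp add: D.digit_dim_def card_pos_full_words l_def ln_inverse ln_realpow)
    finally show ?thesis
      using D.hausdorff_measure_zero_imp[OF segment_times_code_subset_attractor[OF n] zero] by simp
  qed
  have "(\<lambda>n::nat. ln (real n + 1) / real n) \<longlonglongrightarrow> 0"
    by real_asymp
  then have "(\<lambda>n::nat. 1 + (ln \<beta> - ln (real n + 1) / real n) / l) \<longlonglongrightarrow> 1 + (ln \<beta> - 0) / l"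
    using l by (intro tendsto_intros) auto
  moreover have "\<forall>\<^sub>F n in sequentially. 1 + (ln \<beta> - ln (real n + 1) / real n) / l \<le> s"
    using eventually_gt_at_top[of 0] by eventually_elim (rule ge)
  ultimately have "1 + (ln \<beta> - 0) / l \<le> s"
    by (intro tendsto_upperbound) auto
  then show ?thesis by (simp add: l_def)
qed

end

theorem theorem4p1:
  fixes \<beta> \<tau> :: real
  assumes "1 < \<beta>" "\<beta> < 2" and "0 < \<tau>" "\<tau> < 1 / 2"
  shows "hausdorff_dim (baker_attractor \<beta> \<tau>) = ereal (1 + ln \<beta> / ln (inverse \<tau>))"
proof -
  interpret baker \<beta> \<tau> using assms by unfold_locales
  let ?D = "1 + ln \<beta> / ln (inverse \<tau>)"
  show ?thesis
  proof (rule antisym)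
    have "0 \<le> ln \<beta> / ln (inverse \<tau>)"
      using assms by (intro divide_nonneg_pos) (auto simp: ln_inverse)
    then have D0: "0 \<le> ?D" by simp
    show "hausdorff_dim (baker_attractor \<beta> \<tau>) \<le> ereal ?D"
    \<comment> \<open>Measure zero is established only strictly above \<open>?D\<close>, so the
      infimum is tested at \<open>?D + e\<close>.\<close>
    proof (rule ereal_le_epsilon2)
      fix e :: real assume "0 < e"
      then show "hausdorff_dim (baker_attractor \<beta> \<tau>) \<le> ereal ?D + ereal e"
        unfolding hausdorff_dim_def plus_ereal.simps
        using D0 by (intro INF_lower) (auto intro!: hausdorff_measure_attractor_zero)
    qed
    show "ereal ?D \<le> hausdorff_dim (baker_attractor \<beta> \<tau>)"
      unfolding hausdorff_dim_def
      by (intro INF_greatest) (auto intro: hausdorff_measure_attractor_zero_imp)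
  qed
qed

end
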